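(* Let $n\ge 1$ and, for $j\in\{1,2,\dots,n\}$, let $A_j\in\mathcal{B}(H)$ be a selfadjoint operator with $\operatorname{sp}(A_j)\subset[\gamma,\Gamma]$, for some real numbers $\gamma<\Gamma$. Let $h:[\gamma,\Gamma]\to\mathbb{R}$ be non-negative and continuous and let $f,g:[\gamma,\Gamma]\to\mathbb{R}$ be continuous. If $f$ and $g$ are $h$-synchronous on $[\gamma,\Gamma]$, then $$\sum_{j=1}^n\langle h^2(A_j)x_j,x_j\rangle\ \sum_{j=1}^n\langle f(A_j)g(A_j)x_j,x_j\rangle\ \ge\ \sum_{j=1}^n\langle h(A_j)g(A_j)x_j,x_j\rangle\ \sum_{j=1}^n\langle h(A_j)f(A_j)x_j,x_j\rangle$$ for all $x_1,\dots,x_n\in H$ with $\sum_{j=1}^n\|x_j\|^2=1$. If $f$ and $g$ are $h$-asynchronous on $[\gamma,\Gamma]$, then the reverse inequality ($\le$) holds for all such $x_1,\dots,x_n$.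
   Context: $(H,\langle\cdot,\cdot\rangle)$ is a complex Hilbert space, $\mathcal{B}(H)$ is the algebra of bounded linear operators on $H$, and $\operatorname{sp}(A)$ is the spectrum of $A$. For a selfadjoint $A$ and a continuous function $f$ on $\operatorname{sp}(A)$, $f(A)$ is defined by the continuous functional calculus; $h^2$ is the pointwise square of $h$. Given a non-negative function $h:[a,b]\to\mathbb{R}_+$, two functions $f,g:[a,b]\to\mathbb{R}$ are called $h$-synchronous (respectively $h$-asynchronous) on $[a,b]$ if $(h(y)f(x)-h(x)f(y))(h(y)g(x)-h(x)g(y))\ge 0$ (respectively $\le 0$) for all $x,y\in[a,b]$. *)

theory Defs
  imports "HOL-Analysis.Analysis" "HOL-Library.Complex_Order"
begin

section \<open>Complex Hilbert spaces\<close>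

text \<open>The inner product is linear in its first argument.\<close>

class complex_inner_space = real_normed_vector +
  fixes scaleC :: "complex \<Rightarrow> 'a \<Rightarrow> 'a"  (infixr "*\<^sub>C" 75)
    and cinner :: "'a \<Rightarrow> 'a \<Rightarrow> complex"
  assumes scaleC_add_right: "a *\<^sub>C (x + y) = a *\<^sub>C x + a *\<^sub>C y"
    and scaleC_add_left: "(a + b) *\<^sub>C x = a *\<^sub>C x + b *\<^sub>C x"
    and scaleC_scaleC: "a *\<^sub>C (b *\<^sub>C x) = (a * b) *\<^sub>C x"
    and scaleR_eq_scaleC: "r *\<^sub>R x = complex_of_real r *\<^sub>C x"
    and cinner_commute: "cinner x y = cnj (cinner y x)"
    and cinner_add_left: "cinner (x + y) z = cinner x z + cinner y z"
    and cinner_scaleC_left: "cinner (a *\<^sub>C x) y = a * cinner x y"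
    and cinner_self_nonneg: "0 \<le> cinner x x"
    and cinner_self_eq_zero_iff: "cinner x x = 0 \<longleftrightarrow> x = 0"
    and norm_eq_sqrt_cinner: "norm x = sqrt (Re (cinner x x))"

class complex_hilbert_space = complex_inner_space + banach


section \<open>Bounded operators and their spectrum\<close>

text \<open>The elements of \<open>'h \<Rightarrow>\<^sub>L 'h\<close> are only real-linear; \<open>B(H)\<close> is the set of the complex-linear
  ones, with the operator norm inherited from \<open>'h \<Rightarrow>\<^sub>L 'h\<close>.\<close>

definition bounded_operators :: "('h::complex_hilbert_space \<Rightarrow>\<^sub>L 'h) set" where
  "bounded_operators = {A. \<forall>c x. blinfun_apply A (c *\<^sub>C x) = c *\<^sub>C blinfun_apply A x}"

definition is_adjoint :: "('h::complex_hilbert_space \<Rightarrow>\<^sub>L 'h) \<Rightarrow> ('h \<Rightarrow>\<^sub>L 'h) \<Rightarrow> bool" where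
  "is_adjoint A B \<longleftrightarrow>
    (\<forall>x y. cinner (blinfun_apply A x) y = cinner x (blinfun_apply B y))"

definition selfadjoint :: "('h::complex_hilbert_space \<Rightarrow>\<^sub>L 'h) \<Rightarrow> bool" where
  "selfadjoint A \<longleftrightarrow> A \<in> bounded_operators \<and> is_adjoint A A"

text \<open>The two equations below say that \<open>R\<close> is a two-sided inverse of \<open>A - \<mu> I\<close>.\<close>

definition spectrum :: "('h::complex_hilbert_space \<Rightarrow>\<^sub>L 'h) \<Rightarrow> complex set" where
  "spectrum A = {\<mu>. \<not> (\<exists>R \<in> bounded_operators. \<forall>x.
      blinfun_apply R (blinfun_apply A x - \<mu> *\<^sub>C x) = x \<and>
      blinfun_apply A (blinfun_apply R x) - \<mu> *\<^sub>C blinfun_apply R x = x)}"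


section \<open>Continuous functional calculus\<close>

text \<open>\<open>\<Phi>\<close> is an isometric unital *-homomorphism from \<open>C(sp(A))\<close> into \<open>B(H)\<close> that sends
  the identity function to \<open>A\<close>.  (Its image is then automatically the C*-algebra generated by
  \<open>A\<close> and \<open>I\<close>.)  A continuous function on \<open>sp(A)\<close> is represented by a function on the complex
  plane that is continuous on \<open>sp(A)\<close>; by isometry \<open>\<Phi> u\<close> depends only on \<open>u\<close> restricted to
  \<open>sp(A)\<close>.\<close>

definition gelfand_map ::
    "('h::complex_hilbert_space \<Rightarrow>\<^sub>L 'h) \<Rightarrow> ((complex \<Rightarrow> complex) \<Rightarrow> ('h \<Rightarrow>\<^sub>L 'h)) \<Rightarrow> bool" where
  "gelfand_map A \<Phi> \<longleftrightarrow>
    (\<forall>u. continuous_on (spectrum A) u \<longrightarrow>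
        \<Phi> u \<in> bounded_operators
      \<and> is_adjoint (\<Phi> u) (\<Phi> (\<lambda>z. cnj (u z)))
      \<and> norm (\<Phi> u) = (SUP z\<in>spectrum A. cmod (u z))
      \<and> (\<forall>c x. blinfun_apply (\<Phi> (\<lambda>z. c * u z)) x = c *\<^sub>C blinfun_apply (\<Phi> u) x)) \<and>
    (\<forall>u v. continuous_on (spectrum A) u \<longrightarrow> continuous_on (spectrum A) v \<longrightarrow>
        \<Phi> (\<lambda>z. u z + v z) = \<Phi> u + \<Phi> v
      \<and> \<Phi> (\<lambda>z. u z * v z) = \<Phi> u o\<^sub>L \<Phi> v) \<and>
    \<Phi> (\<lambda>z. 1) = id_blinfun \<and>
    \<Phi> (\<lambda>z. z) = A"

text \<open>For selfadjoint \<open>A\<close> on a nonzero space a Gelfand map exists, and by the Weierstrass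
  approximation theorem any two agree on every function continuous on \<open>sp(A)\<close>; so the choice
  below is irrelevant for such functions.\<close>

definition cfun_calc ::
    "('h::complex_hilbert_space \<Rightarrow>\<^sub>L 'h) \<Rightarrow> (complex \<Rightarrow> complex) \<Rightarrow> ('h \<Rightarrow>\<^sub>L 'h)" where
  "cfun_calc A = (SOME \<Phi>. gelfand_map A \<Phi>)"

text \<open>\<open>f(A)\<close> for a real function \<open>f\<close> of a real variable, where \<open>sp(A)\<close> lies on the real line,
  so that \<open>Re\<close> is the identification of \<open>sp(A)\<close> with a set of reals.\<close>

definition fun_calc ::
    "(real \<Rightarrow> real) \<Rightarrow> ('h::complex_hilbert_space \<Rightarrow>\<^sub>L 'h) \<Rightarrow> ('h \<Rightarrow>\<^sub>L 'h)" where
  "fun_calc f A = cfun_calc A (\<lambda>z. complex_of_real (f (Re z)))"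


section \<open>Synchronous functions\<close>

definition h_synchronous ::
    "(real \<Rightarrow> real) \<Rightarrow> real \<Rightarrow> real \<Rightarrow> (real \<Rightarrow> real) \<Rightarrow> (real \<Rightarrow> real) \<Rightarrow> bool" where
  "h_synchronous h a b f g \<longleftrightarrow> (\<forall>x\<in>{a..b}. \<forall>y\<in>{a..b}.
      (h y * f x - h x * f y) * (h y * g x - h x * g y) \<ge> 0)"

definition h_asynchronous ::
    "(real \<Rightarrow> real) \<Rightarrow> real \<Rightarrow> real \<Rightarrow> (real \<Rightarrow> real) \<Rightarrow> (real \<Rightarrow> real) \<Rightarrow> bool" where
  "h_asynchronous h a b f g \<longleftrightarrow> (\<forall>x\<in>{a..b}. \<forall>y\<in>{a..b}.
      (h y * f x - h x * f y) * (h y * g x - h x * g y) \<le> 0)"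

end

theory Submission
  imports Defs "HOL-Computational_Algebra.Fundamental_Theorem_Algebra"
begin

text \<open>
  Fix vectors \<open>x\<^sub>1, \<dots>, x\<^sub>n\<close>, not all zero, and put
  \<open>L F = \<Sum>j. \<langle>F(A\<^sub>j) x\<^sub>j, x\<^sub>j\<rangle>\<close>.  The functional calculus is additive and multiplicative and
  respects adjoints, so \<open>L\<close> is a linear functional on the continuous real functions on
  \<open>[\<gamma>, \<Gamma>]\<close> with real values, and it is positive because a nonnegative \<open>F\<close> is a square.
  The claim reads \<open>L(h g) L(h f) \<le> L(h\<^sup>2) L(f g)\<close>.  For synchronous \<open>f\<close> and \<open>g\<close> this follows
  by applying \<open>L\<close> in each of the two variables to the nonnegative kernel
  \<open>(h t f s - h s f t) (h t g s - h s g t)\<close> (\<open>Chebyshev_positive_functional\<close>).  The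
  asynchronous case is the synchronous one for \<open>-f\<close> and \<open>g\<close>.

  Since \<open>F(A)\<close> is defined by choosing some Gelfand map, all of this requires that a Gelfand map of
  a selfadjoint operator on a nonzero space exists (\<open>gelfand_map_exists\<close>).  Its construction
  rests on the isometry \<open>\<parallel>p(A)\<parallel> = sup {|p(\<mu>)| | \<mu> \<in> sp(A)}\<close> for complex polynomials \<open>p\<close>, after
  which Weierstrass approximation and completeness extend \<open>p \<mapsto> p(A)\<close> to continuous functions.

  The isometry comes from describing the spectrum by lower norm bounds: \<open>\<mu>\<close> lies in \<open>sp(A)\<close> iff
  \<open>A - \<mu> I\<close> is not bounded below (\<open>in_spectrum_iff\<close>).  One half is a perturbation estimate
  (\<open>cmod_poly_le_norm_poly_op\<close>).  For the other half, \<open>\<parallel>p(A)\<parallel>\<^sup>2\<close> is an approximate eigenvalue of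
  \<open>p(A)\<^sup>* p(A)\<close> (\<open>not_bounded_below_norm_squared\<close>); factoring the polynomial
  \<open>(cnj p) p - \<parallel>p(A)\<parallel>\<^sup>2\<close> into linear factors, some factor \<open>A - \<mu> I\<close> is not bounded below, and
  at this \<open>\<mu> \<in> sp(A)\<close> the value \<open>|p(\<mu>)|\<close> equals \<open>\<parallel>p(A)\<parallel>\<close> (\<open>norm_poly_op_attained\<close>).
\<close>

section \<open>Complex inner product spaces\<close>

lemma cinner_add_right:
  fixes x y z :: "'h::complex_inner_space"
  shows "cinner x (y + z) = cinner x y + cinner x z"
  by (metis cinner_add_left cinner_commute complex_cnj_add)

lemma cinner_scaleC_right:
  fixes x y :: "'h::complex_inner_space"
  shows "cinner x (a *\<^sub>C y) = cnj a * cinner x y"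
  by (metis cinner_commute cinner_scaleC_left complex_cnj_mult)

lemma minus_eq_scaleC:
  fixes x :: "'h::complex_inner_space"
  shows "- x = (-1) *\<^sub>C x"
  using scaleR_eq_scaleC[of "-1" x] by simp

lemma cinner_minus_left:
  fixes x y :: "'h::complex_inner_space"
  shows "cinner (- x) y = - cinner x y"
  by (subst minus_eq_scaleC) (simp add: cinner_scaleC_left)

lemma cinner_minus_right:
  fixes x y :: "'h::complex_inner_space"
  shows "cinner x (- y) = - cinner x y"
  by (subst minus_eq_scaleC) (simp add: cinner_scaleC_right)

lemma cinner_diff_left:
  fixes x y z :: "'h::complex_inner_space"
  shows "cinner (x - y) z = cinner x z - cinner y z"
  using cinner_add_left[of x "- y" z] by (simp add: cinner_minus_left)

lemma cinner_diff_right: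
  fixes x y z :: "'h::complex_inner_space"
  shows "cinner x (y - z) = cinner x y - cinner x z"
  using cinner_add_right[of x y "- z"] by (simp add: cinner_minus_right)

lemma cinner_self:
  fixes x :: "'h::complex_inner_space"
  shows "cinner x x = complex_of_real ((norm x)\<^sup>2)"
  using cinner_self_nonneg[of x] by (simp add: norm_eq_sqrt_cinner less_eq_complex_def complex_eq_iff)

lemma norm_scaleC:
  fixes x :: "'h::complex_inner_space"
  shows "norm (a *\<^sub>C x) = cmod a * norm x"
proof -
  have "complex_of_real ((norm (a *\<^sub>C x))\<^sup>2) = complex_of_real ((cmod a * norm x)\<^sup>2)"
    unfolding power_mult_distrib of_real_mult complex_norm_square[of a] cinner_self[symmetric]
    by (simp add: cinner_scaleC_left cinner_scaleC_right)
  then have "(norm (a *\<^sub>C x))\<^sup>2 = (cmod a * norm x)\<^sup>2"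
    by (simp only: of_real_eq_iff)
  then show ?thesis
    by (rule power2_eq_imp_eq) simp_all
qed

lemma Re_cinner_commute:
  fixes x y :: "'h::complex_inner_space"
  shows "Re (cinner x y) = Re (cinner y x)"
  by (subst cinner_commute) simp

lemma norm_diff_squared:
  fixes x y :: "'h::complex_inner_space"
  shows "(norm (x - y))\<^sup>2 = (norm x)\<^sup>2 - 2 * Re (cinner x y) + (norm y)\<^sup>2"
proof -
  have "(norm (x - y))\<^sup>2 = Re (cinner (x - y) (x - y))"
    by (simp add: cinner_self)
  also have "\<dots> = Re (cinner x x) - 2 * Re (cinner x y) + Re (cinner y y)"
    using Re_cinner_commute[of x y] by (simp add: cinner_diff_left cinner_diff_right)
  finally show ?thesis
    by (simp add: cinner_self)
qed

text \<open>Expand \<open>\<parallel>\<parallel>y\<parallel>\<^sup>2 x - \<langle>x, y\<rangle> y\<parallel>\<^sup>2 \<ge> 0\<close>: the vector is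
  \<open>\<parallel>y\<parallel>\<^sup>2\<close> times the component of \<open>x\<close> orthogonal to \<open>y\<close>, a scaling that avoids division.\<close>

lemma Cauchy_Schwarz_cinner:
  fixes x y :: "'h::complex_inner_space"
  shows "cmod (cinner x y) \<le> norm x * norm y"
proof (cases "y = 0")
  case True
  have "cinner x (0 + 0) = cinner x 0 + cinner x (0::'h)" by (rule cinner_add_right)
  then show ?thesis using True by simp
next
  case False
  define c where "c = cinner x y"
  define N where "N = (norm y)\<^sup>2"
  have "N > 0" using False by (simp add: N_def)
  have "0 \<le> (norm (complex_of_real N *\<^sub>C x - c *\<^sub>C y))\<^sup>2" by simp
  also have "\<dots> = N\<^sup>2 * (norm x)\<^sup>2 - 2 * (N * (cmod c)\<^sup>2) + (cmod c)\<^sup>2 * N"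
    by (simp add: norm_diff_squared norm_scaleC power_mult_distrib cinner_scaleC_left
        cinner_scaleC_right c_def[symmetric] cmod_power2 N_def[symmetric])
       (simp add: power2_eq_square algebra_simps)
  also have "\<dots> = N * (N * (norm x)\<^sup>2 - (cmod c)\<^sup>2)"
    by (simp add: power2_eq_square algebra_simps)
  finally have "(cmod c)\<^sup>2 \<le> N * (norm x)\<^sup>2"
    using \<open>N > 0\<close> by (simp add: zero_le_mult_iff)
  then have "(cmod c)\<^sup>2 \<le> (norm x * norm y)\<^sup>2"
    by (simp add: N_def power_mult_distrib ac_simps)
  then show ?thesis
    unfolding c_def by (rule power2_le_imp_le) simp
qed

lemma bounded_bilinear_cinner: "bounded_bilinear (cinner :: 'h::complex_inner_space \<Rightarrow> _)"
proof
  show "\<exists>K. \<forall>a b::'h. norm (cinner a b) \<le> norm a * norm b * K"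
    by (rule exI[of _ 1]) (simp add: Cauchy_Schwarz_cinner)
qed (simp_all add: cinner_add_left cinner_add_right scaleR_eq_scaleC cinner_scaleC_left
    cinner_scaleC_right scaleR_conv_of_real)

lemma bounded_linear_scaleC: "bounded_linear (\<lambda>x::'h::complex_inner_space. a *\<^sub>C x)"
proof (rule bounded_linear_intro)
  show "a *\<^sub>C (r *\<^sub>R x) = r *\<^sub>R (a *\<^sub>C x)" for r and x :: 'h
    by (simp add: scaleR_eq_scaleC scaleC_scaleC mult.commute)
  show "norm (a *\<^sub>C x) \<le> norm x * cmod a" for x :: 'h
    by (simp add: norm_scaleC)
qed (rule scaleC_add_right)

lemma scaleC_zero_left:
  fixes x :: "'h::complex_inner_space"
  shows "0 *\<^sub>C x = 0"
  using scaleR_eq_scaleC[of 0 x] by simp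

lemma scaleC_minus_left:
  fixes x :: "'h::complex_inner_space"
  shows "(- a) *\<^sub>C x = - (a *\<^sub>C x)"
  using scaleC_add_left[of a "- a" x] by (simp add: scaleC_zero_left eq_neg_iff_add_eq_0 add.commute)

lemma scaleC_zero_right: "a *\<^sub>C (0::'h::complex_inner_space) = 0"
  using scaleC_add_right[of a 0 "0::'h"] by simp

lemma scaleC_one:
  fixes x :: "'h::complex_inner_space"
  shows "1 *\<^sub>C x = x"
  using scaleR_eq_scaleC[of 1 x] by simp


section \<open>Polynomials of an operator\<close>

definition scaleC_op :: "complex \<Rightarrow> ('h::complex_hilbert_space \<Rightarrow>\<^sub>L 'h)" where
  "scaleC_op a = Blinfun (\<lambda>x. a *\<^sub>C x)"

lemma scaleC_op_apply [simp]: "blinfun_apply (scaleC_op a) x = a *\<^sub>C x"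
  by (simp add: scaleC_op_def bounded_linear_Blinfun_apply bounded_linear_scaleC)

text \<open>Horner's scheme.  The recursion over the coefficients makes every algebraic law of this map
  an induction on the polynomial.\<close>

definition poly_op :: "('h::complex_hilbert_space \<Rightarrow>\<^sub>L 'h) \<Rightarrow> complex poly \<Rightarrow> ('h \<Rightarrow>\<^sub>L 'h)" where
  "poly_op A p = fold_coeffs (\<lambda>a T. scaleC_op a + (A o\<^sub>L T)) p 0"

lemma poly_op_0 [simp]: "poly_op A 0 = 0"
  by (simp add: poly_op_def)

lemma poly_op_pCons:
  "blinfun_apply (poly_op A (pCons a p)) x = a *\<^sub>C x + blinfun_apply A (blinfun_apply (poly_op A p) x)"
  by (cases "p = 0 \<and> a = 0")
    (auto simp: poly_op_def blinfun.bilinear_simps scaleC_zero_left)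

lemma poly_op_add: "poly_op A (p + q) = poly_op A p + poly_op A q"
proof (induction p q rule: poly_induct2)
  case (pCons a p b q)
  show ?case
    by (rule blinfun_eqI)
      (simp add: pCons poly_op_pCons blinfun.bilinear_simps scaleC_add_left)
qed simp

lemma poly_op_one: "poly_op A 1 = id_blinfun"
  by (rule blinfun_eqI) (simp add: one_pCons poly_op_pCons blinfun.bilinear_simps scaleC_one)

lemma poly_op_const: "poly_op A [:c:] = scaleC_op c"
  by (rule blinfun_eqI) (simp add: poly_op_pCons blinfun.bilinear_simps)

lemma poly_op_linear_factor:
  "blinfun_apply (poly_op A [:- c, 1:]) x = blinfun_apply A x - c *\<^sub>C x"
  by (simp add: poly_op_pCons blinfun.bilinear_simps scaleC_one scaleC_minus_left)

lemma poly_op_X: "poly_op A [:0, 1:] = A"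
  by (rule blinfun_eqI) (simp add: poly_op_pCons blinfun.bilinear_simps scaleC_one scaleC_zero_left)

lemma bounded_operators_scaleC:
  "A \<in> bounded_operators \<Longrightarrow> blinfun_apply A (c *\<^sub>C x) = c *\<^sub>C blinfun_apply A x"
  by (simp add: bounded_operators_def)

lemma poly_op_in_bounded_operators:
  assumes "A \<in> bounded_operators"
  shows "poly_op A p \<in> bounded_operators"
  unfolding bounded_operators_def
proof (clarify, goal_cases)
  case (1 c x)
  show ?case
  proof (induction p)
    case 0
    show ?case by (simp add: blinfun.bilinear_simps scaleC_zero_right)
  next
    case (pCons a p)
    then show ?case
      by (simp add: poly_op_pCons bounded_operators_scaleC[OF assms] scaleC_add_right scaleC_scaleC mult.commute)
  qed
qed

lemma poly_op_smult:
  assumes "A \<in> bounded_operators"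
  shows "blinfun_apply (poly_op A (smult c p)) x = c *\<^sub>C blinfun_apply (poly_op A p) x"
proof (induction p)
  case 0
  show ?case by (simp add: blinfun.bilinear_simps scaleC_zero_right)
next
  case (pCons a p)
  then show ?case
    by (simp add: poly_op_pCons bounded_operators_scaleC[OF assms] scaleC_add_right scaleC_scaleC)
qed

lemma poly_op_diff:
  assumes "A \<in> bounded_operators"
  shows "poly_op A (p - q) = poly_op A p - poly_op A q"
proof -
  have "poly_op A p = poly_op A (p - q) + poly_op A q"
    by (simp flip: poly_op_add)
  then show ?thesis by simp
qed

lemma poly_op_mult:
  assumes "A \<in> bounded_operators"
  shows "poly_op A (p * q) = poly_op A p o\<^sub>L poly_op A q"
proof (induction p)
  case (pCons a p)
  show ?case
    by (rule blinfun_eqI)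
      (simp add: pCons poly_op_pCons poly_op_add poly_op_smult[OF assms] blinfun.bilinear_simps scaleC_zero_left)
qed (simp add: blinfun_eqI blinfun.bilinear_simps)

lemma poly_op_commute:
  assumes "A \<in> bounded_operators"
  shows "blinfun_apply (poly_op A p) (blinfun_apply (poly_op A q) x) =
    blinfun_apply (poly_op A q) (blinfun_apply (poly_op A p) x)"
  using poly_op_mult[OF assms, of p q] poly_op_mult[OF assms, of q p]
  by (metis blinfun_apply_blinfun_compose mult.commute)

lemma poly_op_adjoint:
  assumes "selfadjoint A"
  shows "is_adjoint (poly_op A p) (poly_op A (map_poly cnj p))"
proof -
  have A: "A \<in> bounded_operators"
    and adj: "\<And>x y. cinner (blinfun_apply A x) y = cinner x (blinfun_apply A y)"
    using assms by (auto simp: selfadjoint_def is_adjoint_def)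
  have "cinner (blinfun_apply (poly_op A p) x) y =
      cinner x (blinfun_apply (poly_op A (map_poly cnj p)) y)" for x y
  proof (induction p arbitrary: y)
    case 0
    show ?case by (simp add: blinfun.bilinear_simps bounded_bilinear.zero_left[OF bounded_bilinear_cinner]
          bounded_bilinear.zero_right[OF bounded_bilinear_cinner])
  next
    case (pCons a p)
    have "blinfun_apply (poly_op A q) (blinfun_apply A y) = blinfun_apply A (blinfun_apply (poly_op A q) y)" for q y
      using poly_op_commute[OF A, of q "[:0, 1:]"] by (simp add: poly_op_X)
    then show ?case
      by (simp add: poly_op_pCons map_poly_pCons cinner_add_left cinner_add_right cinner_scaleC_left
          cinner_scaleC_right adj pCons.IH)
  qed
  then show ?thesis by (simp add: is_adjoint_def)
qed

text \<open>Operators \<open>p(A)\<close> are normal: the adjoint \<open>p(A)\<^sup>*\<close> is again a polynomial in \<open>A\<close> and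
  therefore commutes with \<open>p(A)\<close>, so
  \<open>\<langle>p(A)\<^sup>* x, p(A)\<^sup>* x\<rangle> = \<langle>p(A) x, p(A) x\<rangle>\<close>.\<close>

lemma norm_poly_op_adjoint_apply:
  assumes "selfadjoint A"
  shows "norm (blinfun_apply (poly_op A (map_poly cnj p)) x) = norm (blinfun_apply (poly_op A p) x)"
proof -
  let ?T = "blinfun_apply (poly_op A p)" and ?T' = "blinfun_apply (poly_op A (map_poly cnj p))"
  have A: "A \<in> bounded_operators" using assms by (simp add: selfadjoint_def)
  have adj: "cinner (?T u) v = cinner u (?T' v)" for u v
    using poly_op_adjoint[OF assms] by (simp add: is_adjoint_def)
  have "cinner (?T' x) (?T' x) = cinner (?T (?T' x)) x" by (simp add: adj)
  also have "\<dots> = cinner (?T' (?T x)) x" by (simp add: poly_op_commute[OF A])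
  also have "\<dots> = cnj (cinner (?T x) (?T x))"
    by (metis adj cinner_commute)
  finally have "complex_of_real ((norm (?T' x))\<^sup>2) = complex_of_real ((norm (?T x))\<^sup>2)"
    by (simp add: cinner_self)
  then have "(norm (?T' x))\<^sup>2 = (norm (?T x))\<^sup>2" by (simp only: of_real_eq_iff)
  then show ?thesis by (rule power2_eq_imp_eq) simp_all
qed


section \<open>The spectrum as the set of approximate eigenvalues\<close>

text \<open>For an operator \<open>T - \<mu> I\<close>, failure of this property means that \<open>\<mu>\<close> is an approximate
  eigenvalue of \<open>T\<close>.  It is easier to handle than invertibility because it involves only norm
  inequalities, which pass to factors of a product and survive small perturbations.\<close>

definition bounded_below :: "('a::real_normed_vector \<Rightarrow>\<^sub>L 'b::real_normed_vector) \<Rightarrow> bool" where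
  "bounded_below T \<longleftrightarrow> (\<exists>c>0. \<forall>x. c * norm x \<le> norm (blinfun_apply T x))"

lemma bounded_below_compose:
  assumes "bounded_below S" "bounded_below T"
  shows "bounded_below (S o\<^sub>L T)"
proof -
  obtain c d where c: "c > 0" "\<And>x. c * norm x \<le> norm (blinfun_apply S x)"
    and d: "d > 0" "\<And>x. d * norm x \<le> norm (blinfun_apply T x)"
    using assms by (auto simp: bounded_below_def)
  have "c * d * norm x \<le> norm (blinfun_apply (S o\<^sub>L T) x)" for x
  proof -
    have "c * (d * norm x) \<le> c * norm (blinfun_apply T x)"
      using c(1) d(2)[of x] by simp
    also have "\<dots> \<le> norm (blinfun_apply (S o\<^sub>L T) x)"
      using c(2) by simp
    finally show ?thesis by simp
  qed
  then show ?thesis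
    using c(1) d(1) unfolding bounded_below_def by (intro exI[of _ "c * d"]) simp
qed

lemma bounded_below_composeD:
  assumes "bounded_below (S o\<^sub>L T)"
  shows "bounded_below T"
proof -
  obtain c where c: "c > 0" "\<And>x. c * norm x \<le> norm (blinfun_apply S (blinfun_apply T x))"
    using assms by (auto simp: bounded_below_def)
  have "c / (norm S + 1) * norm x \<le> norm (blinfun_apply T x)" for x
  proof -
    have "c * norm x \<le> norm S * norm (blinfun_apply T x)"
      using c(2)[of x] norm_blinfun[of S "blinfun_apply T x"] by linarith
    also have "\<dots> \<le> (norm S + 1) * norm (blinfun_apply T x)"
      by (intro mult_right_mono) simp_all
    finally show ?thesis
      by (simp add: pos_divide_le_eq add_nonneg_pos mult.commute)
  qed
  then show ?thesis
    using c(1) unfolding bounded_below_def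
    by (intro exI[of _ "c / (norm S + 1)"]) (simp add: add_nonneg_pos)
qed

lemma bounded_below_perturb:
  assumes "\<And>x. c * norm x \<le> norm (blinfun_apply T x)"
    and "\<And>x. norm (blinfun_apply S x - blinfun_apply T x) \<le> d * norm x" and "d < c"
  shows "bounded_below S"
proof -
  have "(c - d) * norm x \<le> norm (blinfun_apply S x)" for x
    using assms(1,2)[of x] norm_triangle_ineq3[of "blinfun_apply S x" "blinfun_apply T x"]
    by (simp add: left_diff_distrib)
  with \<open>d < c\<close> show ?thesis
    unfolding bounded_below_def by (intro exI[of _ "c - d"]) simp
qed

text \<open>Put \<open>P = T T\<^sup>*\<close>.  Normality gives
  \<open>\<langle>x, P x\<rangle> = \<parallel>T\<^sup>* x\<parallel>\<^sup>2 = \<parallel>T x\<parallel>\<^sup>2 \<ge> c\<^sup>2 \<parallel>x\<parallel>\<^sup>2\<close>, which makes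
  \<open>I - P / M\<close> a strict contraction for large \<open>M\<close>.  Banach's fixed point theorem then solves
  \<open>P y = x\<close>, and \<open>T\<^sup>* y\<close> is a preimage of \<open>x\<close> under \<open>T\<close>.  This replaces the usual
  argument with closed range and orthogonal complements.\<close>

lemma surj_of_bounded_below_normal:
  fixes T T' :: "'h::complex_hilbert_space \<Rightarrow>\<^sub>L 'h"
  assumes adj: "is_adjoint T T'"
    and normal: "\<And>x. norm (blinfun_apply T' x) = norm (blinfun_apply T x)"
    and "bounded_below T"
  shows "surj (blinfun_apply T)"
proof (rule surjI)
  obtain c where c: "c > 0" "\<And>x. c * norm x \<le> norm (blinfun_apply T x)"
    using assms(3) by (auto simp: bounded_below_def)
  \<comment> \<open>\<open>M\<close> must dominate \<open>\<parallel>T\<parallel>\<^sup>2\<close> for the quadratic term and \<open>c\<^sup>2\<close> so that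
    the contraction constant \<open>k\<close> is real; the sum does both and stays positive when \<open>T = 0\<close>.\<close>
  define M where "M = (norm T)\<^sup>2 + c\<^sup>2"
  define k where "k = sqrt (1 - c\<^sup>2 / M)"
  have "M > 0" using c(1) by (simp add: M_def add_nonneg_pos)
  have ratio: "0 < c\<^sup>2 / M" "c\<^sup>2 / M \<le> 1"
    using c(1) \<open>M > 0\<close> by (auto simp: M_def)
  have k: "0 \<le> k" "k < 1"
    using ratio by (auto simp: k_def real_sqrt_lt_1_iff)
  let ?P = "\<lambda>x. blinfun_apply T (blinfun_apply T' x)"
  have contraction: "norm (x - (1 / M) *\<^sub>R ?P x) \<le> k * norm x" for x
  proof (rule power2_le_imp_le)
    let ?a = "(norm (blinfun_apply T x))\<^sup>2"
    have "cinner (?P x) x = of_real ?a"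
      using adj by (simp add: is_adjoint_def cinner_self normal)
    then have "Re (cinner x (?P x)) = ?a"
      by (subst Re_cinner_commute) simp
    then have inner: "Re (cinner x ((1 / M) *\<^sub>R ?P x)) = ?a / M"
      by (simp only: scaleR_eq_scaleC cinner_scaleC_right) simp
    have "norm (?P x) \<le> norm T * norm (blinfun_apply T x)"
      using norm_blinfun[of T "blinfun_apply T' x"] by (simp add: normal)
    then have "(norm (?P x))\<^sup>2 \<le> (norm T)\<^sup>2 * ?a"
      by (metis norm_ge_zero power_mono power_mult_distrib)
    also have "\<dots> \<le> M * ?a"
      by (intro mult_right_mono) (simp_all add: M_def)
    finally have "(norm ((1 / M) *\<^sub>R ?P x))\<^sup>2 \<le> ?a / M"
      using \<open>M > 0\<close> by (simp add: power_mult_distrib power_divide power2_eq_square field_simps)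
    then have "(norm (x - (1 / M) *\<^sub>R ?P x))\<^sup>2 \<le> (norm x)\<^sup>2 - ?a / M"
      unfolding norm_diff_squared inner by linarith
    also have "\<dots> \<le> (norm x)\<^sup>2 - (c * norm x)\<^sup>2 / M"
      using c \<open>M > 0\<close> by (simp add: divide_right_mono power_mono)
    also have "\<dots> = (k * norm x)\<^sup>2"
      using ratio by (simp add: k_def power_mult_distrib left_diff_distrib)
    finally show "(norm (x - (1 / M) *\<^sub>R ?P x))\<^sup>2 \<le> (k * norm x)\<^sup>2" .
  qed (use k in simp)
  have "\<exists>y. ?P y = x" for x
  proof -
    let ?F = "\<lambda>y. y - (1 / M) *\<^sub>R (?P y - x)"
    have "dist (?F y) (?F z) \<le> k * dist y z" for y z
    proof -
      have "?F y - ?F z = (y - z) - (1 / M) *\<^sub>R ?P (y - z)"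
        by (simp add: blinfun.bilinear_simps algebra_simps)
      then show ?thesis using contraction[of "y - z"] by (simp only: dist_norm)
    qed
    then obtain y where "?F y = y"
      using banach_fix_type[OF k, of ?F] by blast
    then have "?P y = x" using \<open>M > 0\<close> by simp
    then show ?thesis by blast
  qed
  then show "blinfun_apply T (blinfun_apply T' (SOME y. ?P y = x)) = x" for x
    by (rule someI_ex)
qed

text \<open>A resolvent bounds \<open>A - \<mu> I\<close> from below.  Conversely \<open>A - \<mu> I\<close> is normal, so if it is
  bounded below it is bijective, and the lower bound is exactly the continuity of its inverse.\<close>

lemma in_spectrum_iff:
  assumes "selfadjoint A"
  shows "\<mu> \<in> spectrum A \<longleftrightarrow> \<not> bounded_below (poly_op A [:- \<mu>, 1:])"
proof -
  let ?T = "poly_op A [:- \<mu>, 1:]"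
  have A: "A \<in> bounded_operators" using assms by (simp add: selfadjoint_def)
  have T_scale: "blinfun_apply ?T (a *\<^sub>C x) = a *\<^sub>C blinfun_apply ?T x" for a x
    by (rule bounded_operators_scaleC[OF poly_op_in_bounded_operators[OF A]])
  have "bounded_below ?T" if resolvent: "\<mu> \<notin> spectrum A"
  proof -
    obtain R where "\<And>x. blinfun_apply R (blinfun_apply ?T x) = x"
      using resolvent by (auto simp: spectrum_def poly_op_linear_factor)
    then have "R o\<^sub>L ?T = id_blinfun" by (intro blinfun_eqI) simp
    moreover have "bounded_below (id_blinfun :: 'a \<Rightarrow>\<^sub>L 'a)"
      unfolding bounded_below_def by (intro exI[of _ 1]) simp
    ultimately show ?thesis
      by (metis bounded_below_composeD)
  qed
  moreover have "\<mu> \<notin> spectrum A" if bb: "bounded_below ?T"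
  proof -
    obtain c where c: "c > 0" "\<And>x. c * norm x \<le> norm (blinfun_apply ?T x)"
      using bb by (auto simp: bounded_below_def)
    have inj: "x = y" if "blinfun_apply ?T x = blinfun_apply ?T y" for x y
      using c(2)[of "x - y"] c(1) that by (simp add: blinfun.diff_right zero_le_mult_iff mult_le_0_iff)
    have "surj (blinfun_apply ?T)"
      using poly_op_adjoint[OF assms] norm_poly_op_adjoint_apply[OF assms] bb
      by (rule surj_of_bounded_below_normal)
    define R where "R = inv (blinfun_apply ?T)"
    have TR: "blinfun_apply ?T (R x) = x" for x
      unfolding R_def using \<open>surj _\<close> by (simp add: surj_f_inv_f)
    have "bounded_linear R"
    proof (rule bounded_linear_intro)
      show "R (x + y) = R x + R y" for x y
        by (rule inj) (simp only: TR blinfun.add_right)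
      show "R (r *\<^sub>R x) = r *\<^sub>R R x" for r x
        by (rule inj) (simp only: TR blinfun.scaleR_right)
      show "norm (R x) \<le> norm x * (1 / c)" for x
        using c(2)[of "R x"] c(1) by (simp only: TR) (simp add: field_simps)
    qed
    then have R_apply: "blinfun_apply (Blinfun R) = R"
      by (rule bounded_linear_Blinfun_apply)
    have "Blinfun R \<in> bounded_operators"
      unfolding bounded_operators_def
      by clarify (rule inj, simp only: R_apply TR T_scale)
    moreover have "R (blinfun_apply ?T x) = x" for x
      by (rule inj) (simp only: TR)
    ultimately have "\<exists>R\<in>bounded_operators. \<forall>x.
        blinfun_apply R (blinfun_apply ?T x) = x \<and> blinfun_apply ?T (blinfun_apply R x) = x"
      using TR R_apply by metis
    then show ?thesis
      unfolding spectrum_def poly_op_linear_factor by blast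
  qed
  ultimately show ?thesis by blast
qed

text \<open>The imaginary part of \<open>\<langle>(A - \<mu> I) x, x\<rangle>\<close> is \<open>- Im \<mu> \<parallel>x\<parallel>\<^sup>2\<close>, so for nonreal
  \<open>\<mu>\<close> the Cauchy-Schwarz inequality bounds \<open>A - \<mu> I\<close> from below by \<open>|Im \<mu>|\<close>.\<close>

lemma spectrum_selfadjoint_real:
  assumes "selfadjoint A" "\<mu> \<in> spectrum A"
  shows "\<mu> \<in> \<real>"
proof (rule ccontr)
  assume "\<mu> \<notin> \<real>"
  then have "Im \<mu> \<noteq> 0" by (simp add: complex_is_Real_iff)
  let ?T = "poly_op A [:- \<mu>, 1:]"
  have "\<bar>Im \<mu>\<bar> * norm x \<le> norm (blinfun_apply ?T x)" for x
  proof (cases "x = 0")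
    case False
    have "cinner (blinfun_apply A x) x = cnj (cinner (blinfun_apply A x) x)"
      using assms(1) by (metis cinner_commute is_adjoint_def selfadjoint_def)
    then have "Im (cinner (blinfun_apply A x) x) = 0"
      by (simp add: complex_eq_iff)
    then have "\<bar>Im \<mu>\<bar> * (norm x)\<^sup>2 = \<bar>Im (cinner (blinfun_apply ?T x) x)\<bar>"
      by (simp only: poly_op_linear_factor cinner_diff_left cinner_scaleC_left cinner_self)
        (simp add: abs_mult)
    also have "\<dots> \<le> norm (blinfun_apply ?T x) * norm x"
      using abs_Im_le_cmod Cauchy_Schwarz_cinner by (rule order_trans)
    finally show ?thesis
      using False by (simp add: power2_eq_square)
  qed simp
  then have "bounded_below ?T"
    using \<open>Im \<mu> \<noteq> 0\<close> unfolding bounded_below_def by (intro exI[of _ "\<bar>Im \<mu>\<bar>"]) simp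
  with assms show False by (simp add: in_spectrum_iff)
qed


section \<open>Spectral norm formula for polynomials\<close>

text \<open>If \<open>|p(\<mu>)| > \<parallel>p(A)\<parallel>\<close>, then \<open>p(A) - p(\<mu>) I\<close> is a small perturbation of
  \<open>- p(\<mu>) I\<close> and hence bounded below; so is its right factor \<open>A - \<mu> I\<close>.\<close>

lemma cmod_poly_le_norm_poly_op:
  assumes "selfadjoint A" "\<mu> \<in> spectrum A"
  shows "cmod (poly p \<mu>) \<le> norm (poly_op A p)"
proof (rule ccontr)
  assume "\<not> ?thesis"
  then have less: "norm (poly_op A p) < cmod (poly p \<mu>)" by simp
  have A: "A \<in> bounded_operators" using assms(1) by (simp add: selfadjoint_def)
  have "poly (p - [:poly p \<mu>:]) \<mu> = 0" by simp
  then obtain r where r: "p - [:poly p \<mu>:] = r * [:- \<mu>, 1:]"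
    by (metis dvdE mult.commute poly_eq_0_iff_dvd)
  have "bounded_below (poly_op A (p - [:poly p \<mu>:]))"
  proof (rule bounded_below_perturb[OF _ _ less])
    show "cmod (poly p \<mu>) * norm x \<le> norm (blinfun_apply (scaleC_op (- poly p \<mu>)) x)" for x :: 'a
      by (simp add: norm_scaleC)
    show "norm (blinfun_apply (poly_op A (p - [:poly p \<mu>:])) x - blinfun_apply (scaleC_op (- poly p \<mu>)) x)
        \<le> norm (poly_op A p) * norm x" for x
      using norm_blinfun[of "poly_op A p" x]
      by (simp add: poly_op_diff[OF A] blinfun.diff_left poly_op_const scaleC_minus_left)
  qed
  then have "bounded_below (poly_op A [:- \<mu>, 1:])"
    unfolding r poly_op_mult[OF A] by (rule bounded_below_composeD)
  with assms show False by (simp add: in_spectrum_iff)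
qed

text \<open>By the fundamental theorem of algebra \<open>q(A)\<close> is a nonzero multiple of a product of factors \<open>A - \<mu> I\<close> with
  \<open>q(\<mu>) = 0\<close>, and a product of operators that are bounded below is bounded below.\<close>

lemma poly_root_in_spectrum:
  assumes "selfadjoint A"
  shows "q \<noteq> 0 \<Longrightarrow> \<not> bounded_below (poly_op A q) \<Longrightarrow> \<exists>\<mu>\<in>spectrum A. poly q \<mu> = 0"
proof (induction "degree q" arbitrary: q rule: less_induct)
  case less
  have A: "A \<in> bounded_operators" using assms by (simp add: selfadjoint_def)
  show ?case
  proof (cases "degree q = 0")
    case True
    then obtain a where q: "q = [:a:]" by (rule degree_eq_zeroE)
    with less.prems(1) have "bounded_below (poly_op A q)"
      unfolding bounded_below_def
      by (intro exI[of _ "cmod a"]) (simp add: poly_op_const norm_scaleC)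
    with less.prems(2) show ?thesis by simp
  next
    case False
    then obtain \<mu> where \<mu>: "poly q \<mu> = 0"
      using fundamental_theorem_of_algebra[of q] by (auto simp: constant_degree)
    then obtain r where r: "q = [:- \<mu>, 1:] * r"
      by (metis dvdE poly_eq_0_iff_dvd)
    show ?thesis
    proof (cases "\<mu> \<in> spectrum A")
      case True
      with \<mu> show ?thesis by blast
    next
      case False
      then have "bounded_below (poly_op A [:- \<mu>, 1:])"
        by (simp add: in_spectrum_iff[OF assms])
      then have "\<not> bounded_below (poly_op A r)"
        using less.prems(2) bounded_below_compose unfolding r poly_op_mult[OF A] by blast
      moreover have "r \<noteq> 0" using less.prems(1) r by auto
      moreover have "degree r < degree q"
        unfolding r using \<open>r \<noteq> 0\<close> by (subst degree_mult_eq) auto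
      ultimately obtain \<nu> where "\<nu> \<in> spectrum A" "poly r \<nu> = 0"
        using less.hyps by blast
      then show ?thesis unfolding r by auto
    qed
  qed
qed

text \<open>With \<open>T = p(A)\<close> and \<open>N = \<parallel>T\<parallel>\<^sup>2\<close>, the claim is that \<open>N\<close> is an approximate eigenvalue of
  \<open>T\<^sup>* T\<close>.  Indeed
  \<open>\<parallel>(T\<^sup>* T - N I) x\<parallel>\<^sup>2 \<le> 2 N\<^sup>2 \<parallel>x\<parallel>\<^sup>2 - 2 N \<parallel>T x\<parallel>\<^sup>2\<close>, so a lower bound on the left-hand
  side would force \<open>\<parallel>T\<parallel>\<^sup>2 < N\<close> if \<open>N > 0\<close>, while for \<open>N = 0\<close> it fails at every nonzero vector.\<close>

lemma not_bounded_below_norm_squared: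
  fixes A :: "'h::complex_hilbert_space \<Rightarrow>\<^sub>L 'h"
  assumes A: "selfadjoint A" and nontrivial: "\<exists>x::'h. x \<noteq> 0"
  shows "\<not> bounded_below
    (poly_op A (map_poly cnj p * p - [:complex_of_real ((norm (poly_op A p))\<^sup>2):]))"
proof
  define T where "T = poly_op A p"
  define N where "N = (norm T)\<^sup>2"
  define B where "B = poly_op A (map_poly cnj p)"
  let ?D = "poly_op A (map_poly cnj p * p - [:complex_of_real N:])"
  assume "bounded_below (poly_op A (map_poly cnj p * p - [:complex_of_real ((norm (poly_op A p))\<^sup>2):]))"
  then obtain c where c: "c > 0" "\<And>x. c * norm x \<le> norm (blinfun_apply ?D x)"
    by (auto simp: bounded_below_def N_def T_def)
  have bo: "A \<in> bounded_operators" using A by (simp add: selfadjoint_def)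
  have D: "blinfun_apply ?D x = blinfun_apply B (blinfun_apply T x) - N *\<^sub>R x" for x
    by (simp add: poly_op_diff[OF bo] poly_op_mult[OF bo] poly_op_const blinfun.diff_left B_def T_def
        scaleR_eq_scaleC)
  have adj: "cinner (blinfun_apply T x) y = cinner x (blinfun_apply B y)" for x y
    using poly_op_adjoint[OF A] by (simp add: is_adjoint_def T_def B_def)
  have normB: "norm (blinfun_apply B x) = norm (blinfun_apply T x)" for x
    unfolding B_def T_def by (rule norm_poly_op_adjoint_apply[OF A])
  have key: "2 * N * (norm (blinfun_apply T x))\<^sup>2 \<le> (2 * N\<^sup>2 - c\<^sup>2) * (norm x)\<^sup>2" for x
  proof -
    have "(c * norm x)\<^sup>2 \<le> (norm (blinfun_apply ?D x))\<^sup>2"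
      using c by (intro power_mono) simp_all
    also have "\<dots> = (norm (blinfun_apply B (blinfun_apply T x)))\<^sup>2
        - 2 * Re (cinner (blinfun_apply B (blinfun_apply T x)) (N *\<^sub>R x)) + (norm (N *\<^sub>R x))\<^sup>2"
      unfolding D by (rule norm_diff_squared)
    also have "Re (cinner (blinfun_apply B (blinfun_apply T x)) (N *\<^sub>R x)) =
        N * (norm (blinfun_apply T x))\<^sup>2"
    proof -
      have "Re (cinner (blinfun_apply B (blinfun_apply T x)) x) =
          Re (cinner (blinfun_apply T x) (blinfun_apply T x))"
        by (subst Re_cinner_commute) (simp only: adj)
      then show ?thesis
        by (simp add: scaleR_eq_scaleC cinner_scaleC_right cinner_self)
    qed
    finally have expand: "(c * norm x)\<^sup>2 \<le> (norm (blinfun_apply B (blinfun_apply T x)))\<^sup>2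
        - 2 * (N * (norm (blinfun_apply T x))\<^sup>2) + (N * norm x)\<^sup>2"
      by (simp add: power_mult_distrib)
    have "norm (blinfun_apply B (blinfun_apply T x)) \<le> N * norm x"
    proof -
      have "norm (blinfun_apply T (blinfun_apply T x)) \<le> norm T * norm (blinfun_apply T x)"
        by (rule norm_blinfun)
      also have "\<dots> \<le> norm T * (norm T * norm x)"
        by (intro mult_left_mono norm_blinfun) simp
      finally show ?thesis by (simp add: normB N_def power2_eq_square mult.assoc)
    qed
    then have "(norm (blinfun_apply B (blinfun_apply T x)))\<^sup>2 \<le> (N * norm x)\<^sup>2"
      by (intro power_mono) simp_all
    with expand show ?thesis by (simp add: power_mult_distrib algebra_simps)
  qed
  obtain x0 :: 'h where "x0 \<noteq> 0" using nontrivial by blast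
  have "c\<^sup>2 > 0" using c(1) by simp
  show False
  proof (cases "N = 0")
    case True
    then show False using key[of x0] \<open>x0 \<noteq> 0\<close> \<open>c\<^sup>2 > 0\<close> by (simp add: mult_le_0_iff zero_le_mult_iff)
  next
    case False
    then have "N > 0" by (simp add: N_def)
    define K where "K = (2 * N\<^sup>2 - c\<^sup>2) / (2 * N)"
    have TK: "(norm (blinfun_apply T x))\<^sup>2 \<le> K * (norm x)\<^sup>2" for x
      using key[of x] \<open>N > 0\<close> by (simp add: K_def field_simps)
    have "K \<ge> 0"
      using order_trans[OF zero_le_power2 TK[of x0]] \<open>x0 \<noteq> 0\<close> by (simp add: zero_le_mult_iff)
    have "norm T \<le> sqrt K"
    proof (rule norm_blinfun_bound)
      show "norm (blinfun_apply T x) \<le> sqrt K * norm x" for x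
        by (rule power2_le_imp_le) (use TK[of x] \<open>K \<ge> 0\<close> in \<open>simp_all add: power_mult_distrib\<close>)
    qed (use \<open>K \<ge> 0\<close> in simp)
    then have "N \<le> K"
      unfolding N_def using \<open>K \<ge> 0\<close> by (metis norm_ge_zero power_mono real_sqrt_pow2)
    moreover have "K < N"
      using \<open>N > 0\<close> \<open>c\<^sup>2 > 0\<close> by (simp add: K_def field_simps power2_eq_square)
    ultimately show False by simp
  qed
qed

text \<open>The polynomial \<open>z\<^sup>2 - \<parallel>A\<parallel>\<^sup>2\<close> is nonzero, and it has a root in the spectrum because
  \<open>\<parallel>A\<parallel>\<^sup>2\<close> is an approximate eigenvalue of \<open>A\<^sup>2\<close>.\<close>

lemma spectrum_nonempty:
  fixes A :: "'h::complex_hilbert_space \<Rightarrow>\<^sub>L 'h"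
  assumes "selfadjoint A" and "\<exists>x::'h. x \<noteq> 0"
  shows "spectrum A \<noteq> {}"
proof -
  let ?q = "map_poly cnj [:0, 1:] * [:0, 1:] - [:complex_of_real ((norm (poly_op A [:0, 1:]))\<^sup>2):]"
  have "coeff ?q 2 = 1" by (simp add: map_poly_pCons numeral_2_eq_2)
  then have "?q \<noteq> 0" by (metis coeff_0 zero_neq_one)
  then show ?thesis
    using poly_root_in_spectrum[OF assms(1) _ not_bounded_below_norm_squared[OF assms]] by blast
qed

text \<open>The polynomial \<open>q = (cnj p) p - \<parallel>p(A)\<parallel>\<^sup>2\<close> has a root \<open>\<mu>\<close> in the spectrum, and
  \<open>((cnj p) p)(\<mu>) = |p(\<mu>)|\<^sup>2\<close> because \<open>\<mu>\<close> is real.  If \<open>q\<close> vanishes identically, any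
  point of the spectrum will do.  Together with the opposite estimate above this says that
  \<open>p \<mapsto> p(A)\<close> is isometric for the supremum norm on the spectrum.\<close>

lemma norm_poly_op_attained:
  fixes A :: "'h::complex_hilbert_space \<Rightarrow>\<^sub>L 'h"
  assumes A: "selfadjoint A" and nontrivial: "\<exists>x::'h. x \<noteq> 0"
  shows "\<exists>\<mu>\<in>spectrum A. norm (poly_op A p) = cmod (poly p \<mu>)"
proof -
  let ?q = "map_poly cnj p * p - [:complex_of_real ((norm (poly_op A p))\<^sup>2):]"
  have "\<exists>\<mu>\<in>spectrum A. poly ?q \<mu> = 0"
    using poly_root_in_spectrum[OF A _ not_bounded_below_norm_squared[OF assms]]
      spectrum_nonempty[OF assms] by (cases "?q = 0") auto
  then obtain \<mu> where \<mu>: "\<mu> \<in> spectrum A" "poly ?q \<mu> = 0" by blast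
  have "cnj \<mu> = \<mu>"
    using spectrum_selfadjoint_real[OF A \<mu>(1)] by (simp add: Reals_cnj_iff)
  then have "complex_of_real ((cmod (poly p \<mu>))\<^sup>2) = complex_of_real ((norm (poly_op A p))\<^sup>2)"
    using \<mu>(2) by (simp add: complex_norm_square mult.commute del: of_real_power)
  then have "(cmod (poly p \<mu>))\<^sup>2 = (norm (poly_op A p))\<^sup>2"
    by (simp only: of_real_eq_iff)
  then have "cmod (poly p \<mu>) = norm (poly_op A p)"
    by (rule power2_eq_imp_eq) simp_all
  with \<mu>(1) show ?thesis by force
qed

lemma compact_spectrum:
  assumes A: "selfadjoint A"
  shows "compact (spectrum A)"
proof -
  have "bounded (spectrum A)"
    using cmod_poly_le_norm_poly_op[OF A, of _ "[:0, 1:]"] by (auto simp: bounded_iff)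
  moreover have "open (- spectrum A)"
  proof (rule openI)
    fix \<mu> assume "\<mu> \<in> - spectrum A"
    then obtain c where c: "c > 0" "\<And>x. c * norm x \<le> norm (blinfun_apply (poly_op A [:- \<mu>, 1:]) x)"
      using in_spectrum_iff[OF A] by (auto simp: bounded_below_def)
    have "\<nu> \<in> - spectrum A" if "\<nu> \<in> ball \<mu> c" for \<nu>
    proof -
      have "bounded_below (poly_op A [:- \<nu>, 1:])"
      proof (rule bounded_below_perturb[OF c(2)])
        show "norm (blinfun_apply (poly_op A [:- \<nu>, 1:]) x - blinfun_apply (poly_op A [:- \<mu>, 1:]) x)
            \<le> cmod (\<mu> - \<nu>) * norm x" for x
          using scaleC_add_left[of "\<mu> - \<nu>" \<nu> x]
          by (simp add: poly_op_linear_factor norm_scaleC)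
        show "cmod (\<mu> - \<nu>) < c" using that by (simp add: dist_norm)
      qed
      then show ?thesis by (simp add: in_spectrum_iff[OF A])
    qed
    then show "\<exists>e>0. ball \<mu> e \<subseteq> - spectrum A" using c(1) by blast
  qed
  ultimately show ?thesis
    by (simp add: compact_eq_bounded_closed closed_def)
qed


section \<open>The continuous functional calculus\<close>

text \<open>Approximate the real and the imaginary part separately by real polynomials; on real
  arguments these remain the real and the imaginary part of the combined polynomial.\<close>

lemma complex_Weierstrass_on_reals:
  fixes u :: "complex \<Rightarrow> complex"
  assumes "compact S" "S \<subseteq> \<real>" "continuous_on S u" "e > 0"
  shows "\<exists>p. \<forall>z\<in>S. cmod (poly p z - u z) < e"
proof -
  define K where "K = Re ` S"
  have S: "S = of_real ` K" "of_real ` K \<subseteq> S"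
    using assms(2) by (auto simp: K_def image_image complex_is_Real_iff complex_eq_iff subset_iff image_iff)
  have "compact K"
    unfolding K_def by (intro compact_continuous_image continuous_intros assms)
  have cont: "continuous_on K (\<lambda>t. u (of_real t))"
    by (rule continuous_on_compose2[OF assms(3) _ S(2)]) (intro continuous_intros)
  have approx: "\<exists>p. \<forall>t\<in>K. poly p (of_real t) \<in> \<real> \<and> \<bar>v t - Re (poly p (complex_of_real t))\<bar> < e / 2"
    if v: "continuous_on K v" for v :: "real \<Rightarrow> real"
  proof -
    obtain g where g: "real_polynomial_function g" "\<And>t. t \<in> K \<Longrightarrow> \<bar>v t - g t\<bar> < e / 2"
      using Stone_Weierstrass_real_polynomial_function[OF \<open>compact K\<close> v, of "e / 2"] \<open>e > 0\<close> by auto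
    obtain a n where a: "g = (\<lambda>x. \<Sum>i\<le>n. a i * x ^ i)"
      using g(1) real_polynomial_function_iff_sum by blast
    have "poly (\<Sum>i\<le>n. monom (complex_of_real (a i)) i) (of_real t) = of_real (g t)" for t
      by (simp add: a poly_sum poly_monom)
    then show ?thesis
      using g(2) by (intro exI[of _ "\<Sum>i\<le>n. monom (complex_of_real (a i)) i"]) simp
  qed
  obtain p where p: "\<And>t. t \<in> K \<Longrightarrow> poly p (of_real t) \<in> \<real>"
      "\<And>t. t \<in> K \<Longrightarrow> \<bar>Re (u (of_real t)) - Re (poly p (complex_of_real t))\<bar> < e / 2"
    using approx[of "\<lambda>t. Re (u (of_real t))"] cont continuous_on_Re by blast
  obtain q where q: "\<And>t. t \<in> K \<Longrightarrow> poly q (of_real t) \<in> \<real>"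
      "\<And>t. t \<in> K \<Longrightarrow> \<bar>Im (u (of_real t)) - Re (poly q (complex_of_real t))\<bar> < e / 2"
    using approx[of "\<lambda>t. Im (u (of_real t))"] cont continuous_on_Im by blast
  have "cmod (poly (p + smult \<i> q) (of_real t) - u (of_real t)) < e" if t: "t \<in> K" for t
  proof -
    let ?w = "poly (p + smult \<i> q) (of_real t) - u (of_real t)"
    have "Im (poly p (of_real t)) = 0" "Im (poly q (of_real t)) = 0"
      using p(1)[OF t] q(1)[OF t] by (simp_all add: complex_is_Real_iff)
    then have "\<bar>Re ?w\<bar> < e / 2" "\<bar>Im ?w\<bar> < e / 2"
      using p(2)[OF t] q(2)[OF t] by (simp_all add: abs_minus_commute)
    then show ?thesis using cmod_le[of ?w] by linarith
  qed
  then show ?thesis unfolding S(1) by (intro exI[of _ "p + smult \<i> q"]) blast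
qed

text \<open>\<open>T\<close> is a candidate for \<open>u(A)\<close>.  A relation postpones existence and uniqueness of the limit,
  and the algebraic laws of the calculus are then limit laws for it.\<close>

definition calc_limit ::
    "('h::complex_hilbert_space \<Rightarrow>\<^sub>L 'h) \<Rightarrow> (complex \<Rightarrow> complex) \<Rightarrow> ('h \<Rightarrow>\<^sub>L 'h) \<Rightarrow> bool" where
  "calc_limit A u T \<longleftrightarrow> (\<exists>p. uniform_limit (spectrum A) (\<lambda>n. poly (p n)) u sequentially \<and>
    (\<lambda>n. poly_op A (p n)) \<longlonglongrightarrow> T)"

lemma calc_limit_poly:
  assumes "\<And>z. poly p z = u z"
  shows "calc_limit A u (poly_op A p)"
proof -
  have "u = poly p" using assms by (simp add: fun_eq_iff)
  then show ?thesis
    unfolding calc_limit_def by (intro exI[of _ "\<lambda>_. p"]) (simp add: uniform_limit_const)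
qed

lemma calc_limit_add:
  assumes "calc_limit A u T" "calc_limit A v T'"
  shows "calc_limit A (\<lambda>z. u z + v z) (T + T')"
proof -
  obtain p q where "uniform_limit (spectrum A) (\<lambda>n. poly (p n)) u sequentially"
    "uniform_limit (spectrum A) (\<lambda>n. poly (q n)) v sequentially"
    "(\<lambda>n. poly_op A (p n)) \<longlonglongrightarrow> T" "(\<lambda>n. poly_op A (q n)) \<longlonglongrightarrow> T'"
    using assms by (auto simp: calc_limit_def)
  moreover have "poly (p n + q n) = (\<lambda>z. poly (p n) z + poly (q n) z)" for n
    by (simp add: fun_eq_iff)
  ultimately show ?thesis
    unfolding calc_limit_def
    by (intro exI[of _ "\<lambda>n. p n + q n"]) (simp add: poly_op_add uniform_limit_add tendsto_add)
qed

lemma calc_limit_in_bounded_operators: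
  assumes "A \<in> bounded_operators" "calc_limit A u T"
  shows "T \<in> bounded_operators"
proof -
  obtain p where p: "(\<lambda>n. poly_op A (p n)) \<longlonglongrightarrow> T"
    using assms(2) by (auto simp: calc_limit_def)
  have "blinfun_apply T (c *\<^sub>C x) = c *\<^sub>C blinfun_apply T x" for c x
  proof (rule LIMSEQ_unique)
    show "(\<lambda>n. blinfun_apply (poly_op A (p n)) (c *\<^sub>C x)) \<longlonglongrightarrow> blinfun_apply T (c *\<^sub>C x)"
      using p by (intro tendsto_intros)
    have "(\<lambda>n. c *\<^sub>C blinfun_apply (poly_op A (p n)) x) \<longlonglongrightarrow> c *\<^sub>C blinfun_apply T x"
      using p by (intro bounded_linear.tendsto[OF bounded_linear_scaleC] tendsto_intros)
    then show "(\<lambda>n. blinfun_apply (poly_op A (p n)) (c *\<^sub>C x)) \<longlonglongrightarrow> c *\<^sub>C blinfun_apply T x"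
      by (simp add: bounded_operators_scaleC[OF poly_op_in_bounded_operators[OF assms(1)]])
  qed
  then show ?thesis by (simp add: bounded_operators_def)
qed

lemma calc_limit_mult:
  assumes A: "selfadjoint A" and u: "calc_limit A u T" "continuous_on (spectrum A) u"
    and v: "calc_limit A v T'" "continuous_on (spectrum A) v"
  shows "calc_limit A (\<lambda>z. u z * v z) (T o\<^sub>L T')"
proof -
  have bo: "A \<in> bounded_operators" using A by (simp add: selfadjoint_def)
  obtain p q where lim: "uniform_limit (spectrum A) (\<lambda>n. poly (p n)) u sequentially"
    "uniform_limit (spectrum A) (\<lambda>n. poly (q n)) v sequentially"
    "(\<lambda>n. poly_op A (p n)) \<longlonglongrightarrow> T" "(\<lambda>n. poly_op A (q n)) \<longlonglongrightarrow> T'"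
    using u(1) v(1) by (auto simp: calc_limit_def)
  have "bounded (u ` spectrum A)" "bounded (v ` spectrum A)"
    using u(2) v(2) compact_spectrum[OF A] compact_continuous_image compact_imp_bounded by blast+
  then have "uniform_limit (spectrum A) (\<lambda>n z. poly (p n) z * poly (q n) z) (\<lambda>z. u z * v z) sequentially"
    using lim by (intro uniform_lim_mult)
  moreover have "(\<lambda>n. poly_op A (p n) o\<^sub>L poly_op A (q n)) \<longlonglongrightarrow> (T o\<^sub>L T')"
    using lim by (intro bounded_bilinear.tendsto[OF bounded_bilinear_blinfun_compose])
  moreover have "poly (p n * q n) = (\<lambda>z. poly (p n) z * poly (q n) z)" for n
    by (simp add: fun_eq_iff)
  ultimately show ?thesis
    unfolding calc_limit_def
    by (intro exI[of _ "\<lambda>n. p n * q n"]) (simp add: poly_op_mult[OF bo])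
qed

lemma calc_limit_cmod_le:
  assumes A: "selfadjoint A" and "calc_limit A u T" "z \<in> spectrum A"
  shows "cmod (u z) \<le> norm T"
proof -
  obtain p where p: "uniform_limit (spectrum A) (\<lambda>n. poly (p n)) u sequentially"
    "(\<lambda>n. poly_op A (p n)) \<longlonglongrightarrow> T"
    using assms(2) by (auto simp: calc_limit_def)
  show ?thesis
  proof (rule LIMSEQ_le)
    show "(\<lambda>n. cmod (poly (p n) z)) \<longlonglongrightarrow> cmod (u z)"
      by (intro tendsto_norm tendsto_uniform_limitI[OF p(1) assms(3)])
    show "(\<lambda>n. norm (poly_op A (p n))) \<longlonglongrightarrow> norm T"
      by (intro tendsto_norm p(2))
    show "\<exists>N. \<forall>n\<ge>N. cmod (poly (p n) z) \<le> norm (poly_op A (p n))"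
      using cmod_poly_le_norm_poly_op[OF A assms(3)] by blast
  qed
qed

lemma calc_limit_norm_le:
  fixes A :: "'h::complex_hilbert_space \<Rightarrow>\<^sub>L 'h"
  assumes A: "selfadjoint A" and nontrivial: "\<exists>x::'h. x \<noteq> 0"
    and "calc_limit A u T" and bound: "\<And>z. z \<in> spectrum A \<Longrightarrow> cmod (u z) \<le> b"
  shows "norm T \<le> b"
proof (rule field_le_epsilon)
  fix e :: real assume "e > 0"
  obtain p where p: "uniform_limit (spectrum A) (\<lambda>n. poly (p n)) u sequentially"
    "(\<lambda>n. poly_op A (p n)) \<longlonglongrightarrow> T"
    using assms(3) by (auto simp: calc_limit_def)
  show "norm T \<le> b + e"
  proof (rule tendsto_upperbound[OF tendsto_norm[OF p(2)]])
    show "\<forall>\<^sub>F n in sequentially. norm (poly_op A (p n)) \<le> b + e"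
      using uniform_limitD[OF p(1) \<open>e > 0\<close>]
    proof eventually_elim
      case (elim n)
      obtain \<mu> where \<mu>: "\<mu> \<in> spectrum A" "norm (poly_op A (p n)) = cmod (poly (p n) \<mu>)"
        using norm_poly_op_attained[OF A nontrivial] by blast
      then have "dist (poly (p n) \<mu>) (u \<mu>) < e" "cmod (u \<mu>) \<le> b"
        using elim bound by auto
      then show ?case
        using norm_triangle_ineq2[of "poly (p n) \<mu>" "u \<mu>"] by (simp add: \<mu>(2) dist_norm)
    qed
  qed simp
qed

lemma calc_limit_norm:
  fixes A :: "'h::complex_hilbert_space \<Rightarrow>\<^sub>L 'h"
  assumes A: "selfadjoint A" and nontrivial: "\<exists>x::'h. x \<noteq> 0"
    and "calc_limit A u T"
  shows "norm T = (SUP z\<in>spectrum A. cmod (u z))"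
proof (rule cSup_eq_non_empty[symmetric])
  show "(\<lambda>z. cmod (u z)) ` spectrum A \<noteq> {}"
    using spectrum_nonempty[OF A nontrivial] by simp
  show "x \<le> norm T" if "x \<in> (\<lambda>z. cmod (u z)) ` spectrum A" for x
    using that calc_limit_cmod_le[OF A assms(3)] by auto
  show "norm T \<le> b" if "\<And>x. x \<in> (\<lambda>z. cmod (u z)) ` spectrum A \<Longrightarrow> x \<le> b" for b
    using that by (intro calc_limit_norm_le[OF A nontrivial assms(3)]) auto
qed

text \<open>The limit \<open>T\<close> does not depend on the approximating sequence, because two sequences with the
  same uniform limit on the spectrum have images that approach each other, by isometry.\<close>

lemma poly_op_tendsto_calc_limit:
  fixes A :: "'h::complex_hilbert_space \<Rightarrow>\<^sub>L 'h"
  assumes A: "selfadjoint A" and nontrivial: "\<exists>x::'h. x \<noteq> 0"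
    and T: "calc_limit A u T"
    and p: "uniform_limit (spectrum A) (\<lambda>n. poly (p n)) u sequentially"
  shows "(\<lambda>n. poly_op A (p n)) \<longlonglongrightarrow> T"
proof -
  have bo: "A \<in> bounded_operators" using A by (simp add: selfadjoint_def)
  obtain q where q: "uniform_limit (spectrum A) (\<lambda>n. poly (q n)) u sequentially"
    "(\<lambda>n. poly_op A (q n)) \<longlonglongrightarrow> T"
    using T by (auto simp: calc_limit_def)
  have "(\<lambda>n. poly_op A (p n) - poly_op A (q n)) \<longlonglongrightarrow> 0"
  proof (rule tendstoI)
    fix e :: real assume "e > 0"
    then have "e / 2 > 0" by simp
    show "\<forall>\<^sub>F n in sequentially. dist (poly_op A (p n) - poly_op A (q n)) 0 < e"
      using uniform_limitD[OF p \<open>e / 2 > 0\<close>] uniform_limitD[OF q(1) \<open>e / 2 > 0\<close>]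
    proof eventually_elim
      case (elim n)
      obtain \<mu> where \<mu>: "\<mu> \<in> spectrum A" "norm (poly_op A (p n - q n)) = cmod (poly (p n - q n) \<mu>)"
        using norm_poly_op_attained[OF A nontrivial] by blast
      then have "dist (poly (p n) \<mu>) (poly (q n) \<mu>) < e"
        using elim by (blast intro: dist_triangle_half_l)
      with \<mu>(2) show ?case by (simp add: poly_op_diff[OF bo] dist_norm)
    qed
  qed
  from tendsto_add[OF this q(2)] show ?thesis by simp
qed

lemma calc_limit_unique:
  fixes A :: "'h::complex_hilbert_space \<Rightarrow>\<^sub>L 'h"
  assumes A: "selfadjoint A" and nontrivial: "\<exists>x::'h. x \<noteq> 0"
    and T: "calc_limit A u T" and T': "calc_limit A u T'"
  shows "T = T'"
proof -
  obtain p where p: "uniform_limit (spectrum A) (\<lambda>n. poly (p n)) u sequentially"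
    using T by (auto simp: calc_limit_def)
  show ?thesis
    by (rule LIMSEQ_unique; rule poly_op_tendsto_calc_limit[OF A nontrivial _ p]) fact+
qed

text \<open>Polynomials that converge to \<open>u\<close> uniformly on the compact spectrum have a Cauchy sequence
  of images, by isometry.\<close>

lemma calc_limit_exists:
  fixes A :: "'h::complex_hilbert_space \<Rightarrow>\<^sub>L 'h"
  assumes A: "selfadjoint A" and nontrivial: "\<exists>x::'h. x \<noteq> 0"
    and cont: "continuous_on (spectrum A) u"
  shows "\<exists>T. calc_limit A u T"
proof -
  have bo: "A \<in> bounded_operators" using A by (simp add: selfadjoint_def)
  have "\<exists>p. \<forall>z\<in>spectrum A. cmod (poly p z - u z) < inverse (real (Suc n))" for n
    by (rule complex_Weierstrass_on_reals[OF compact_spectrum[OF A] _ cont])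
      (use spectrum_selfadjoint_real[OF A] in auto)
  then obtain p where p: "\<And>n z. z \<in> spectrum A \<Longrightarrow> cmod (poly (p n) z - u z) < inverse (real (Suc n))"
    by metis
  have lim: "uniform_limit (spectrum A) (\<lambda>n. poly (p n)) u sequentially"
  proof (rule uniform_limitI)
    fix e :: real assume "e > 0"
    show "\<forall>\<^sub>F n in sequentially. \<forall>z\<in>spectrum A. dist (poly (p n) z) (u z) < e"
      using order_tendstoD(2)[OF LIMSEQ_inverse_real_of_nat \<open>e > 0\<close>]
      by eventually_elim (use p in \<open>force simp: dist_norm intro: less_trans\<close>)
  qed
  have "Cauchy (\<lambda>n. poly_op A (p n))"
  proof (rule CauchyI)
    fix e :: real assume "e > 0"
    obtain N where N: "\<And>n z. n \<ge> N \<Longrightarrow> z \<in> spectrum A \<Longrightarrow> dist (poly (p n) z) (u z) < e / 2"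
      using uniform_limitD[OF lim, of "e / 2"] \<open>e > 0\<close> by (auto simp: eventually_sequentially)
    have "norm (poly_op A (p m) - poly_op A (p n)) < e" if mn: "m \<ge> N" "n \<ge> N" for m n
    proof -
      obtain \<mu> where \<mu>: "\<mu> \<in> spectrum A" "norm (poly_op A (p m - p n)) = cmod (poly (p m - p n) \<mu>)"
        using norm_poly_op_attained[OF A nontrivial] by blast
      then show ?thesis
        using dist_triangle_half_l[OF N[OF mn(1) \<mu>(1)] N[OF mn(2) \<mu>(1)]]
        by (simp add: poly_op_diff[OF bo] dist_norm)
    qed
    then show "\<exists>M. \<forall>m\<ge>M. \<forall>n\<ge>M. norm (poly_op A (p m) - poly_op A (p n)) < e" by blast
  qed
  then obtain T where "(\<lambda>n. poly_op A (p n)) \<longlonglongrightarrow> T"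
    using Cauchy_convergent_iff convergent_def by blast
  with lim show ?thesis unfolding calc_limit_def by blast
qed

lemma calc_limit_adjoint:
  fixes A :: "'h::complex_hilbert_space \<Rightarrow>\<^sub>L 'h"
  assumes A: "selfadjoint A" and nontrivial: "\<exists>x::'h. x \<noteq> 0"
    and T: "calc_limit A u T" and T': "calc_limit A (\<lambda>z. cnj (u z)) T'"
  shows "is_adjoint T T'"
proof -
  obtain p where p: "uniform_limit (spectrum A) (\<lambda>n. poly (p n)) u sequentially"
    using T by (auto simp: calc_limit_def)
  have "uniform_limit (spectrum A) (\<lambda>n z. cnj (poly (p n) z)) (\<lambda>z. cnj (u z)) sequentially"
    by (intro bounded_linear_uniform_limit_intros p)
  moreover have "cnj (poly (p n) z) = poly (map_poly cnj (p n)) z" if "z \<in> spectrum A" for n z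
    using spectrum_selfadjoint_real[OF A that] by (simp add: Reals_cnj_iff)
  ultimately have "uniform_limit (spectrum A) (\<lambda>n. poly (map_poly cnj (p n))) (\<lambda>z. cnj (u z)) sequentially"
    by (simp cong: uniform_limit_cong')
  note lim = poly_op_tendsto_calc_limit[OF A nontrivial T p]
    poly_op_tendsto_calc_limit[OF A nontrivial T' this]
  have "cinner (blinfun_apply T x) y = cinner x (blinfun_apply T' y)" for x y
  proof (rule LIMSEQ_unique)
    show "(\<lambda>n. cinner (blinfun_apply (poly_op A (p n)) x) y) \<longlonglongrightarrow> cinner (blinfun_apply T x) y"
      by (intro bounded_bilinear.tendsto[OF bounded_bilinear_cinner] tendsto_intros lim)
    have "(\<lambda>n. cinner x (blinfun_apply (poly_op A (map_poly cnj (p n))) y)) \<longlonglongrightarrow> cinner x (blinfun_apply T' y)"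
      by (intro bounded_bilinear.tendsto[OF bounded_bilinear_cinner] tendsto_intros lim)
    then show "(\<lambda>n. cinner (blinfun_apply (poly_op A (p n)) x) y) \<longlonglongrightarrow> cinner x (blinfun_apply T' y)"
      using poly_op_adjoint[OF A] by (simp add: is_adjoint_def)
  qed
  then show ?thesis by (simp add: is_adjoint_def)
qed

theorem gelfand_map_exists:
  fixes A :: "'h::complex_hilbert_space \<Rightarrow>\<^sub>L 'h"
  assumes A: "selfadjoint A" and nontrivial: "\<exists>x::'h. x \<noteq> 0"
  shows "\<exists>\<Phi>. gelfand_map A \<Phi>"
proof -
  have bo: "A \<in> bounded_operators" using A by (simp add: selfadjoint_def)
  define \<Phi> where "\<Phi> u = (SOME T. calc_limit A u T)" for u
  have \<Phi>: "calc_limit A u (\<Phi> u)" if "continuous_on (spectrum A) u" for u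
    unfolding \<Phi>_def by (rule someI_ex) (rule calc_limit_exists[OF A nontrivial that])
  have \<Phi>_eq: "\<Phi> u = T" if "calc_limit A u T" for u T
    unfolding \<Phi>_def by (rule some_equality[where P = "calc_limit A u"])
      (auto intro: that calc_limit_unique[OF A nontrivial])
  have mult: "\<Phi> (\<lambda>z. u z * v z) = \<Phi> u o\<^sub>L \<Phi> v"
    if "continuous_on (spectrum A) u" "continuous_on (spectrum A) v" for u v
    by (intro \<Phi>_eq calc_limit_mult[OF A] \<Phi> that)
  have const: "\<Phi> (\<lambda>z. c) = scaleC_op c" for c
    using \<Phi>_eq[OF calc_limit_poly[of "[:c:]"]] by (simp add: poly_op_const)
  show ?thesis
    unfolding gelfand_map_def
  proof (intro exI[of _ \<Phi>] conjI allI impI)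
    fix u v :: "complex \<Rightarrow> complex" assume u: "continuous_on (spectrum A) u" and v: "continuous_on (spectrum A) v"
    show "\<Phi> (\<lambda>z. u z + v z) = \<Phi> u + \<Phi> v"
      by (intro \<Phi>_eq calc_limit_add \<Phi> u v)
    show "\<Phi> (\<lambda>z. u z * v z) = \<Phi> u o\<^sub>L \<Phi> v" by (rule mult[OF u v])
  next
    fix u :: "complex \<Rightarrow> complex" assume u: "continuous_on (spectrum A) u"
    show "\<Phi> u \<in> bounded_operators"
      by (rule calc_limit_in_bounded_operators[OF bo \<Phi>[OF u]])
    show "norm (\<Phi> u) = (SUP z\<in>spectrum A. cmod (u z))"
      by (rule calc_limit_norm[OF A nontrivial \<Phi>[OF u]])
    show "is_adjoint (\<Phi> u) (\<Phi> (\<lambda>z. cnj (u z)))"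
      by (intro calc_limit_adjoint[OF A nontrivial \<Phi>[OF u]] \<Phi> continuous_on_cnj u)
    show "blinfun_apply (\<Phi> (\<lambda>z. c * u z)) x = c *\<^sub>C blinfun_apply (\<Phi> u) x" for c x
      using mult[of "\<lambda>z. c" u] u by (simp add: const)
  next
    show "\<Phi> (\<lambda>z. 1) = id_blinfun"
      using \<Phi>_eq[OF calc_limit_poly[of 1]] by (simp add: poly_op_one)
    show "\<Phi> (\<lambda>z. z) = A"
      using \<Phi>_eq[OF calc_limit_poly[of "[:0, 1:]"]] by (simp add: poly_op_X)
  qed
qed


section \<open>Quadratic forms of the functional calculus\<close>

text \<open>Isometry gives \<open>\<parallel>\<Phi> (v - u)\<parallel> = 0\<close>.  The spectrum must be nonempty since the supremum of the
  empty set of reals is unspecified.\<close>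

lemma gelfand_map_cong:
  fixes A :: "'h::complex_hilbert_space \<Rightarrow>\<^sub>L 'h"
  assumes \<Phi>: "gelfand_map A \<Phi>" and nonempty: "spectrum A \<noteq> {}"
    and u: "continuous_on (spectrum A) u" and v: "continuous_on (spectrum A) v"
    and eq: "\<And>z. z \<in> spectrum A \<Longrightarrow> u z = v z"
  shows "\<Phi> u = \<Phi> v"
proof -
  let ?d = "\<lambda>z. v z + (-1) * u z"
  have d: "continuous_on (spectrum A) ?d"
    by (intro continuous_intros u v)
  have "norm (\<Phi> ?d) = (SUP z\<in>spectrum A. cmod (?d z))"
    using \<Phi> d unfolding gelfand_map_def by blast
  also have "\<dots> = (SUP z\<in>spectrum A. 0)"
    by (rule SUP_cong) (simp_all add: eq)
  finally have "\<Phi> ?d = 0" using nonempty by simp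
  then have "\<Phi> u + \<Phi> ?d = \<Phi> u" by simp
  moreover have "\<Phi> (\<lambda>z. u z + ?d z) = \<Phi> u + \<Phi> ?d"
    using \<Phi> u d unfolding gelfand_map_def by blast
  ultimately show ?thesis by simp
qed

context
  fixes A :: "'h::complex_hilbert_space \<Rightarrow>\<^sub>L 'h" and a b :: real
  assumes selfadjoint: "selfadjoint A" and nontrivial: "\<exists>x::'h. x \<noteq> 0"
    and spectrum: "spectrum A \<subseteq> complex_of_real ` {a..b}"
begin

lemma gelfand_map_cfun_calc: "gelfand_map A (cfun_calc A)"
  unfolding cfun_calc_def by (rule someI_ex[OF gelfand_map_exists[OF selfadjoint nontrivial]])

lemma continuous_on_spectrum_of_real:
  fixes F :: "real \<Rightarrow> real"
  assumes "continuous_on {a..b} F"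
  shows "continuous_on (spectrum A) (\<lambda>z. complex_of_real (F (Re z)))"
  by (intro continuous_on_of_real continuous_on_compose2[OF assms] continuous_intros)
    (use spectrum in auto)

lemma fun_calc_add:
  assumes "continuous_on {a..b} F" "continuous_on {a..b} G"
  shows "fun_calc (\<lambda>t. F t + G t) A = fun_calc F A + fun_calc G A"
  using gelfand_map_cfun_calc assms[THEN continuous_on_spectrum_of_real]
  unfolding gelfand_map_def fun_calc_def of_real_add by blast

lemma fun_calc_mult:
  assumes "continuous_on {a..b} F" "continuous_on {a..b} G"
  shows "fun_calc (\<lambda>t. F t * G t) A = fun_calc F A o\<^sub>L fun_calc G A"
  using gelfand_map_cfun_calc assms[THEN continuous_on_spectrum_of_real]
  unfolding gelfand_map_def fun_calc_def of_real_mult by blast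

lemma fun_calc_scale:
  assumes "continuous_on {a..b} F"
  shows "blinfun_apply (fun_calc (\<lambda>t. c * F t) A) x = complex_of_real c *\<^sub>C blinfun_apply (fun_calc F A) x"
  using gelfand_map_cfun_calc assms[THEN continuous_on_spectrum_of_real]
  unfolding gelfand_map_def fun_calc_def of_real_mult by blast

lemma fun_calc_adjoint:
  assumes "continuous_on {a..b} F"
  shows "cinner (blinfun_apply (fun_calc F A) x) y = cinner x (blinfun_apply (fun_calc F A) y)"
proof -
  have "is_adjoint (fun_calc F A) (cfun_calc A (\<lambda>z. cnj (complex_of_real (F (Re z)))))"
    using gelfand_map_cfun_calc assms[THEN continuous_on_spectrum_of_real]
    unfolding gelfand_map_def fun_calc_def by blast
  then show ?thesis by (simp add: is_adjoint_def fun_calc_def)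
qed

lemma fun_calc_form_real:
  assumes "continuous_on {a..b} F"
  shows "cinner (blinfun_apply (fun_calc F A) x) x \<in> \<real>"
  using fun_calc_adjoint[OF assms] by (metis Reals_cnj_iff cinner_commute)

text \<open>On the spectrum \<open>F\<close> is the square of \<open>G = \<surd>|F|\<close>, so
  \<open>\<langle>F(A) x, x\<rangle> = \<langle>G(A) x, G(A) x\<rangle>\<close>.\<close>

lemma fun_calc_form_nonneg:
  assumes F: "continuous_on {a..b} F" and nonneg: "\<And>t. t \<in> {a..b} \<Longrightarrow> 0 \<le> F t"
  shows "0 \<le> Re (cinner (blinfun_apply (fun_calc F A) x) x)"
proof -
  define G where "G t = sqrt \<bar>F t\<bar>" for t
  have G: "continuous_on {a..b} G"
    unfolding G_def by (intro continuous_intros F)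
  have "fun_calc F A = fun_calc (\<lambda>t. G t * G t) A"
    unfolding fun_calc_def
  proof (rule gelfand_map_cong[OF gelfand_map_cfun_calc spectrum_nonempty[OF selfadjoint nontrivial]])
    show "complex_of_real (F (Re z)) = complex_of_real (G (Re z) * G (Re z))" if "z \<in> spectrum A" for z
      using that spectrum nonneg by (auto simp: G_def)
  qed (intro continuous_on_spectrum_of_real F G continuous_on_mult)+
  then have "cinner (blinfun_apply (fun_calc F A) x) x =
      cinner (blinfun_apply (fun_calc G A) x) (blinfun_apply (fun_calc G A) x)"
    by (simp add: fun_calc_mult[OF G G] fun_calc_adjoint[OF G])
  then show ?thesis by (simp add: cinner_self)
qed

end


section \<open>The Chebyshev inequality for positive functionals\<close>

text \<open>The classical proof of Chebyshev's inequality, with \<open>L\<close> in the role of the integral.  The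
  kernel \<open>(h t f s - h s f t) (h t g s - h s g t)\<close> is nonnegative.  Applying \<open>L\<close> in the
  variable \<open>s\<close> leaves a continuous function of \<open>t\<close>, which is nonnegative on the interval;
  applying \<open>L\<close> once more gives twice the difference of the two sides.\<close>

lemma Chebyshev_positive_functional:
  fixes L :: "(real \<Rightarrow> real) \<Rightarrow> real"
  assumes add: "\<And>F G. continuous_on {a..b} F \<Longrightarrow> continuous_on {a..b} G \<Longrightarrow>
      L (\<lambda>t. F t + G t) = L F + L G"
    and scale: "\<And>c F. continuous_on {a..b} F \<Longrightarrow> L (\<lambda>t. c * F t) = c * L F"
    and pos: "\<And>F. continuous_on {a..b} F \<Longrightarrow> (\<And>t. t \<in> {a..b} \<Longrightarrow> 0 \<le> F t) \<Longrightarrow> 0 \<le> L F"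
    and cont: "continuous_on {a..b} f" "continuous_on {a..b} g" "continuous_on {a..b} h"
    and sync: "h_synchronous h a b f g"
  shows "L (\<lambda>t. h t * g t) * L (\<lambda>t. h t * f t) \<le> L (\<lambda>t. (h t)\<^sup>2) * L (\<lambda>t. f t * g t)"
proof -
  let ?hh = "L (\<lambda>t. (h t)\<^sup>2)" and ?fg = "L (\<lambda>t. f t * g t)"
    and ?hf = "L (\<lambda>t. h t * f t)" and ?hg = "L (\<lambda>t. h t * g t)"
  note ci = cont continuous_intros
  have expand: "L (\<lambda>s. c1 * (f s * g s) + (c2 * (h s * f s) + (c3 * (h s * g s) + c4 * (h s)\<^sup>2))) =
      c1 * ?fg + (c2 * ?hf + (c3 * ?hg + c4 * ?hh))" for c1 c2 c3 c4
    by (subst add scale, (intro ci)+)+ simp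
  have kernel: "0 \<le> (h t)\<^sup>2 * ?fg + ((- (h t * g t)) * ?hf + ((- (h t * f t)) * ?hg + (f t * g t) * ?hh))"
    if t: "t \<in> {a..b}" for t
    unfolding expand[symmetric]
  proof (rule pos)
    fix s assume s: "s \<in> {a..b}"
    have "(h t)\<^sup>2 * (f s * g s) + ((- (h t * g t)) * (h s * f s) + ((- (h t * f t)) * (h s * g s) + (f t * g t) * (h s)\<^sup>2))
        = (h t * f s - h s * f t) * (h t * g s - h s * g t)"
      by (simp add: power2_eq_square algebra_simps)
    also have "\<dots> \<ge> 0" using sync s t by (simp add: h_synchronous_def)
    finally show "0 \<le> (h t)\<^sup>2 * (f s * g s) + ((- (h t * g t)) * (h s * f s) +
        ((- (h t * f t)) * (h s * g s) + (f t * g t) * (h s)\<^sup>2))" .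
  qed (intro ci)
  \<comment> \<open>The same combination read as a function of \<open>t\<close>, in the shape that \<open>expand\<close> rewrites.\<close>
  have "0 \<le> L (\<lambda>t. ?hh * (f t * g t) + ((- ?hg) * (h t * f t) + ((- ?hf) * (h t * g t) + ?fg * (h t)\<^sup>2)))"
  proof (rule pos)
    show "0 \<le> ?hh * (f t * g t) + ((- ?hg) * (h t * f t) + ((- ?hf) * (h t * g t) + ?fg * (h t)\<^sup>2))"
      if "t \<in> {a..b}" for t
      using kernel[OF that] by (simp add: algebra_simps)
  qed (intro ci)
  also have "\<dots> = 2 * (?hh * ?fg - ?hg * ?hf)"
    unfolding expand by (simp add: algebra_simps)
  finally show ?thesis by simp
qed


section \<open>The inequality for operators\<close>

theorem theorem2p23:
  fixes A :: "nat \<Rightarrow> ('h::complex_hilbert_space \<Rightarrow>\<^sub>L 'h)"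
    and \<gamma> \<Gamma> :: real and n :: nat and f g h :: "real \<Rightarrow> real"
  assumes "n \<ge> 1" and "\<gamma> < \<Gamma>"
    and "\<And>j. j \<in> {1..n} \<Longrightarrow> selfadjoint (A j)"
    and "\<And>j. j \<in> {1..n} \<Longrightarrow> spectrum (A j) \<subseteq> complex_of_real ` {\<gamma>..\<Gamma>}"
    and "continuous_on {\<gamma>..\<Gamma>} h" and "\<And>t. t \<in> {\<gamma>..\<Gamma>} \<Longrightarrow> h t \<ge> 0"
    and "continuous_on {\<gamma>..\<Gamma>} f" and "continuous_on {\<gamma>..\<Gamma>} g"
  shows "(h_synchronous h \<gamma> \<Gamma> f g \<longrightarrow>
      (\<forall>x :: nat \<Rightarrow> 'h. (\<Sum>j=1..n. (norm (x j))\<^sup>2) = 1 \<longrightarrow>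
        (\<Sum>j=1..n. cinner (blinfun_apply (fun_calc (\<lambda>t. (h t)\<^sup>2) (A j)) (x j)) (x j)) *
        (\<Sum>j=1..n. cinner (blinfun_apply (fun_calc f (A j) o\<^sub>L fun_calc g (A j)) (x j)) (x j))
        \<ge>
        (\<Sum>j=1..n. cinner (blinfun_apply (fun_calc h (A j) o\<^sub>L fun_calc g (A j)) (x j)) (x j)) *
        (\<Sum>j=1..n. cinner (blinfun_apply (fun_calc h (A j) o\<^sub>L fun_calc f (A j)) (x j)) (x j))))
    \<and> (h_asynchronous h \<gamma> \<Gamma> f g \<longrightarrow>
      (\<forall>x :: nat \<Rightarrow> 'h. (\<Sum>j=1..n. (norm (x j))\<^sup>2) = 1 \<longrightarrow>
        (\<Sum>j=1..n. cinner (blinfun_apply (fun_calc (\<lambda>t. (h t)\<^sup>2) (A j)) (x j)) (x j)) *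
        (\<Sum>j=1..n. cinner (blinfun_apply (fun_calc f (A j) o\<^sub>L fun_calc g (A j)) (x j)) (x j))
        \<le>
        (\<Sum>j=1..n. cinner (blinfun_apply (fun_calc h (A j) o\<^sub>L fun_calc g (A j)) (x j)) (x j)) *
        (\<Sum>j=1..n. cinner (blinfun_apply (fun_calc h (A j) o\<^sub>L fun_calc f (A j)) (x j)) (x j))))"
proof -
  note cont = assms(5,7,8)
  define L where "L x F = (\<Sum>j=1..n. Re (cinner (blinfun_apply (fun_calc F (A j)) (x j)) (x j)))"
    for x :: "nat \<Rightarrow> 'h" and F
  \<comment> \<open>The existence of Gelfand maps was shown on nonzero spaces; the normalization of \<open>x\<close>
    provides a nonzero vector.\<close>
  have nontrivial: "\<exists>y::'h. y \<noteq> 0" if "(\<Sum>j=1..n. (norm (x j))\<^sup>2) = 1" for x :: "nat \<Rightarrow> 'h"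
  proof (rule ccontr)
    assume "\<not> ?thesis"
    then have "norm (x j) = 0" for j by simp
    with that show False by simp
  qed
  have form: "(\<Sum>j=1..n. cinner (blinfun_apply (fun_calc F (A j)) (x j)) (x j)) = complex_of_real (L x F)"
    if "(\<Sum>j=1..n. (norm (x j))\<^sup>2) = 1" "continuous_on {\<gamma>..\<Gamma>} F" for x F
    unfolding L_def of_real_sum
    by (intro sum.cong refl of_real_Re[symmetric] fun_calc_form_real[OF assms(3) nontrivial[OF that(1)] assms(4) that(2)])
  have form_mult: "(\<Sum>j=1..n. cinner (blinfun_apply (fun_calc F (A j) o\<^sub>L fun_calc G (A j)) (x j)) (x j)) =
      complex_of_real (L x (\<lambda>t. F t * G t))"
    if x: "(\<Sum>j=1..n. (norm (x j))\<^sup>2) = 1" and F: "continuous_on {\<gamma>..\<Gamma>} F"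
      and G: "continuous_on {\<gamma>..\<Gamma>} G" for x F G
    unfolding form[OF x continuous_on_mult[OF F G], symmetric]
    by (intro sum.cong refl) (simp add: fun_calc_mult[OF assms(3) nontrivial[OF x] assms(4) F G])
  have L_add: "L x (\<lambda>t. F t + G t) = L x F + L x G"
    if x: "(\<Sum>j=1..n. (norm (x j))\<^sup>2) = 1" and F: "continuous_on {\<gamma>..\<Gamma>} F"
      and G: "continuous_on {\<gamma>..\<Gamma>} G" for x F G
    unfolding L_def sum.distrib[symmetric]
    by (intro sum.cong refl)
      (simp add: fun_calc_add[OF assms(3) nontrivial[OF x] assms(4) F G] blinfun.add_left cinner_add_left)
  have L_scale: "L x (\<lambda>t. c * F t) = c * L x F"
    if x: "(\<Sum>j=1..n. (norm (x j))\<^sup>2) = 1" and F: "continuous_on {\<gamma>..\<Gamma>} F" for x F c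
    unfolding L_def sum_distrib_left
    by (intro sum.cong refl)
      (simp add: fun_calc_scale[OF assms(3) nontrivial[OF x] assms(4) F] cinner_scaleC_left)
  have L_pos: "0 \<le> L x F"
    if x: "(\<Sum>j=1..n. (norm (x j))\<^sup>2) = 1" and F: "continuous_on {\<gamma>..\<Gamma>} F"
      and nonneg: "\<And>t. t \<in> {\<gamma>..\<Gamma>} \<Longrightarrow> 0 \<le> F t" for x F
    unfolding L_def
    by (intro sum_nonneg fun_calc_form_nonneg[OF assms(3) nontrivial[OF x] assms(4) F] nonneg)
  have sync: "L x (\<lambda>t. h t * g t) * L x (\<lambda>t. h t * k t) \<le> L x (\<lambda>t. (h t)\<^sup>2) * L x (\<lambda>t. k t * g t)"
    if x: "(\<Sum>j=1..n. (norm (x j))\<^sup>2) = 1" and k: "continuous_on {\<gamma>..\<Gamma>} k" "h_synchronous h \<gamma> \<Gamma> k g" for x k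
    by (rule Chebyshev_positive_functional[OF L_add[OF x] L_scale[OF x] L_pos[OF x]])
      (use cont k in auto)
  \<comment> \<open>Replacing \<open>f\<close> by \<open>-f\<close> turns asynchronous functions into synchronous ones.\<close>
  have async: "L x (\<lambda>t. (h t)\<^sup>2) * L x (\<lambda>t. f t * g t) \<le> L x (\<lambda>t. h t * g t) * L x (\<lambda>t. h t * f t)"
    if x: "(\<Sum>j=1..n. (norm (x j))\<^sup>2) = 1" and "h_asynchronous h \<gamma> \<Gamma> f g" for x
  proof -
    have "h_synchronous h \<gamma> \<Gamma> (\<lambda>t. (-1) * f t) g"
      unfolding h_synchronous_def
    proof (intro ballI)
      fix s t assume "s \<in> {\<gamma>..\<Gamma>}" "t \<in> {\<gamma>..\<Gamma>}"
      then have "(h t * f s - h s * f t) * (h t * g s - h s * g t) \<le> 0"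
        using that(2) by (simp add: h_asynchronous_def)
      then show "0 \<le> (h t * (-1 * f s) - h s * (-1 * f t)) * (h t * g s - h s * g t)"
        by (simp add: algebra_simps)
    qed
    from sync[OF x _ this] have
      "L x (\<lambda>t. h t * g t) * L x (\<lambda>t. (-1) * (h t * f t)) \<le> L x (\<lambda>t. (h t)\<^sup>2) * L x (\<lambda>t. (-1) * (f t * g t))"
      using cont by (simp add: continuous_on_minus)
    also have "L x (\<lambda>t. (-1) * (h t * f t)) = (-1) * L x (\<lambda>t. h t * f t)"
      by (intro L_scale[OF x] continuous_on_mult cont)
    also have "L x (\<lambda>t. (-1) * (f t * g t)) = (-1) * L x (\<lambda>t. f t * g t)"
      by (intro L_scale[OF x] continuous_on_mult cont)
    finally show ?thesis by simp
  qed
  have forms: "(\<Sum>j=1..n. cinner (blinfun_apply (fun_calc (\<lambda>t. (h t)\<^sup>2) (A j)) (x j)) (x j)) =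
        complex_of_real (L x (\<lambda>t. (h t)\<^sup>2))"
      "(\<Sum>j=1..n. cinner (blinfun_apply (fun_calc f (A j) o\<^sub>L fun_calc g (A j)) (x j)) (x j)) =
        complex_of_real (L x (\<lambda>t. f t * g t))"
      "(\<Sum>j=1..n. cinner (blinfun_apply (fun_calc h (A j) o\<^sub>L fun_calc g (A j)) (x j)) (x j)) =
        complex_of_real (L x (\<lambda>t. h t * g t))"
      "(\<Sum>j=1..n. cinner (blinfun_apply (fun_calc h (A j) o\<^sub>L fun_calc f (A j)) (x j)) (x j)) =
        complex_of_real (L x (\<lambda>t. h t * f t))"
    if x: "(\<Sum>j=1..n. (norm (x j))\<^sup>2) = 1" for x
    by (rule form[OF x continuous_on_power[OF cont(1)]] form_mult[OF x] cont)+
  show ?thesis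
  proof (intro conjI impI allI, goal_cases)
    case (1 x)
    show ?case
      unfolding forms[OF 1(2)] using sync[OF 1(2) cont(2) 1(1)] by (simp add: less_eq_complex_def)
  next
    case (2 x)
    show ?case
      unfolding forms[OF 2(2)] using async[OF 2(2,1)] by (simp add: less_eq_complex_def)
  qed
qed

end
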